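(* Let $S$ be a finite set with $q\ge2$ elements, $X=S^{\mathbb N}$ with shift $T$. Let $A\subset\mathbb R$ be finite, let $w=(w_n)_{n\ge0}\in A^{\mathbb N}$ be minimal and uniquely ergodic, and let $f:X\to\mathbb R$ be of bounded variation, i.e. $\sum_{n\ge1}\mathrm{var}_n(f)<\infty$. Then: (H1) for every $\lambda\in\mathbb R$ the limit $$\phi(\lambda)=\lim_{n\to\infty}\frac1n\log\int_X\exp\Big(\lambda\sum_{k=0}^{n-1}w_kf(T^kx)\Big)\,d\sigma(x)$$ exists; (H2) $$\sup_{N\ge1}\ \sup_{x_0=y_0,\dots,x_{N-1}=y_{N-1}}\ \sum_{k=0}^{N-1}|w_kf(T^kx)-w_kf(T^ky)|<\infty.$$
   Context: Points of $X$ are sequences $x=(x_n)_{n\ge0}$ and $(Tx)_n=x_{n+1}$. $\sigma$ is the uniform Bernoulli measure on $X$, giving mass $q^{-n}$ to each cylinder $\{y:y_k=x_k,\ 0\le k<n\}$. For $n\ge1$, $\mathrm{var}_n(f)=\sup\{|f(x)-f(y)|: x_0=y_0,\dots,x_{n-1}=y_{n-1}\}$. Let $\Theta:A^{\mathbb N}\to A^{\mathbb N}$ be the shift. The sequence $w$ is called minimal and uniquely ergodic if the subsystem $(\overline{\{\Theta^kw:k\ge0\}},\Theta)$ (orbit closure in the product topology) is minimal and has exactly one invariant Borel probability measure. *)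

theory Defs
  imports "HOL-Probability.Probability"
begin

definition seq_shift :: "(nat \<Rightarrow> 'a) \<Rightarrow> nat \<Rightarrow> 'a" where
  "seq_shift x = (\<lambda>n. x (Suc n))"

definition uniform_bernoulli :: "(nat \<Rightarrow> 's::finite) measure" where
  "uniform_bernoulli = (\<Pi>\<^sub>M n\<in>UNIV. uniform_count_measure UNIV)"

lemma emeasure_uniform_bernoulli_cylinder:
  fixes x :: "nat \<Rightarrow> 's::finite"
  shows "emeasure uniform_bernoulli {y. \<forall>k<n. y k = x k} = ennreal (1 / real CARD('s) ^ n)"
proof -
  let ?U = "uniform_count_measure (UNIV :: 's set)"
  interpret U: prob_space ?U
    by (rule prob_space_uniform_count_measure) auto
  interpret P: product_prob_space "\<lambda>_. ?U" "UNIV :: nat set" ..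
  have "emeasure (\<Pi>\<^sub>M n\<in>UNIV. ?U)
      (prod_emb UNIV (\<lambda>_. ?U) {..<n} (\<Pi>\<^sub>E k\<in>{..<n}. {x k})) = (\<Prod>k<n. emeasure ?U {x k})"
    by (rule P.emeasure_PiM_emb) (auto simp: sets_uniform_count_measure)
  also have "\<dots> = (\<Prod>k<n. ennreal (1 / real CARD('s)))"
    by (simp add: emeasure_uniform_count_measure)
  also have "\<dots> = ennreal (1 / real CARD('s) ^ n)"
    by (simp add: ennreal_power power_one_over)
  also have "prod_emb UNIV (\<lambda>_. ?U) {..<n} (\<Pi>\<^sub>E k\<in>{..<n}. {x k}) = {y. \<forall>k<n. y k = x k}"
    unfolding prod_emb_def space_uniform_count_measure PiE_UNIV_domain
    by (intro set_eqI) (simp add: PiE_iff Ball_def)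
  finally show ?thesis
    by (simp add: uniform_bernoulli_def)
qed

(* The supremum and the series are taken in [0, \<infinity>], so unbounded f are covered
   and have infinite variation. *)
definition variation :: "nat \<Rightarrow> ((nat \<Rightarrow> 's) \<Rightarrow> real) \<Rightarrow> ennreal" where
  "variation n f = (SUP (x, y)\<in>{(x, y). \<forall>k<n. x k = y k}. ennreal \<bar>f x - f y\<bar>)"

definition bounded_variation_fun :: "((nat \<Rightarrow> 's) \<Rightarrow> real) \<Rightarrow> bool" where
  "bounded_variation_fun f \<longleftrightarrow> (\<Sum>n. variation (Suc n) f) < \<infinity>"

definition minimal_subsystem :: "'a::topological_space set \<Rightarrow> ('a \<Rightarrow> 'a) \<Rightarrow> bool" where
  "minimal_subsystem Y T \<longleftrightarrow> Y \<noteq> {} \<and> T ` Y \<subseteq> Y \<and>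
     (\<forall>F. closedin (top_of_set Y) F \<longrightarrow> T ` F \<subseteq> F \<longrightarrow> F = {} \<or> F = Y)"

definition invariant_borel_prob ::
    "'a::topological_space set \<Rightarrow> ('a \<Rightarrow> 'a) \<Rightarrow> 'a measure \<Rightarrow> bool" where
  "invariant_borel_prob Y T \<mu> \<longleftrightarrow>
     sets \<mu> = sets (restrict_space borel Y) \<and> prob_space \<mu> \<and>
     (\<forall>B\<in>sets \<mu>. emeasure \<mu> (T -` B \<inter> space \<mu>) = emeasure \<mu> B)"

definition uniquely_ergodic_subsystem :: "'a::topological_space set \<Rightarrow> ('a \<Rightarrow> 'a) \<Rightarrow> bool" where
  "uniquely_ergodic_subsystem Y T \<longleftrightarrow> (\<exists>!\<mu>. invariant_borel_prob Y T \<mu>)"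

(* The closure is taken in the product topology of nat \<Rightarrow> real. For a sequence over a finite
   alphabet A this is the closure in the product of the discrete spaces A: the product of copies
   of A is closed (see the lemma below) and A is discrete as a subspace of the reals. *)
definition orbit_closure :: "(nat \<Rightarrow> real) \<Rightarrow> (nat \<Rightarrow> real) set" where
  "orbit_closure w = closure (range (\<lambda>k. (seq_shift ^^ k) w))"

lemma seq_shift_funpow: "(seq_shift ^^ k) x = (\<lambda>n. x (k + n))"
  by (induction k) (auto simp: seq_shift_def)

lemma orbit_closure_subset_alphabet:
  assumes "finite A" "range w \<subseteq> A"
  shows "orbit_closure w \<subseteq> (UNIV \<rightarrow> A)"
proof -
  have "closed {x. x n \<in> A}" for n :: nat
    using closed_vimage[OF finite_imp_closed[OF assms(1)] continuous_on_product_coordinates[of n]]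
    by (simp add: vimage_def)
  then have "closed (\<Inter>n::nat. {x. x n \<in> A})"
    by blast
  also have "(\<Inter>n::nat. {x. x n \<in> A}) = (UNIV \<rightarrow> A)"
    by blast
  finally have "closed (UNIV \<rightarrow> A :: (nat \<Rightarrow> real) set)" .
  then show ?thesis
    unfolding orbit_closure_def
    by (rule closure_minimal[rotated]) (use assms(2) in \<open>auto simp: seq_shift_funpow\<close>)
qed

definition minimal_uniquely_ergodic_seq :: "(nat \<Rightarrow> real) \<Rightarrow> bool" where
  "minimal_uniquely_ergodic_seq w \<longleftrightarrow>
     minimal_subsystem (orbit_closure w) seq_shift \<and>
     uniquely_ergodic_subsystem (orbit_closure w) seq_shift"

end

theory Submission
  imports Defs
begin

text \<open>
  Bounded variation gives (H2) at once, since coordinates agreeing up to \<open>N\<close> leave the tail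
  variations \<open>var_{N-k}(f)\<close> to be summed. For (H1), let \<open>a_n(u)\<close> be the logarithm of the integral
  with weights \<open>u\<close>. Under the Bernoulli measure the first \<open>n\<close> coordinates are independent of the
  shifted point, so bounded distortion makes \<open>a\<close> almost additive: \<open>a_{n+m}(w)\<close> differs from
  \<open>a_n(w) + a_m(\<Theta>^n w)\<close> by a bounded amount. Hence \<open>a_n(w)/n\<close> is within \<open>O(1/m) + O_m(1/n)\<close> of the
  Birkhoff average of \<open>a_m/m\<close> along the orbit of \<open>w\<close>. As \<open>a_m\<close> is continuous, this average converges
  by unique ergodicity, which enters through Helly selection: the orbit closure embeds into the
  line, every weak limit of the empirical measures is invariant, and therefore there is only one.
\<close>

subsection \<open>Birkhoff averages in uniquely ergodic systems\<close>

lemma funpow_mem_invariant: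
  assumes "T ` Y \<subseteq> Y" "w \<in> Y"
  shows "(T ^^ k) w \<in> Y"
  using assms by (induction k) auto

text \<open>The averages are integrals against the empirical measures of the orbit of
  \<open>w\<close>. The injection \<open>h\<close> moves these to the line, where tightness yields
  weakly convergent subsequences; unique ergodicity leaves one possible limit.\<close>

lemma uniquely_ergodic_averages_convergent:
  fixes Y :: "'a::topological_space set" and h g :: "'a \<Rightarrow> real"
  assumes "compact Y" and h: "continuous_on Y h" "inj_on h Y"
    and T: "continuous_on Y T" "T ` Y \<subseteq> Y" and w: "w \<in> Y"
    and ue: "uniquely_ergodic_subsystem Y T"
    and g: "continuous_on Y g"
  shows "convergent (\<lambda>n. (\<Sum>k\<le>n. g ((T ^^ k) w)) / real (Suc n))"
proof -
  define K where "K = h ` Y"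
  obtain r where "homeomorphism Y K h r"
    using homeomorphism_compact[OF \<open>compact Y\<close> h(1) _ h(2)] K_def by blast
  then have r_h: "\<And>y. y \<in> Y \<Longrightarrow> r (h y) = y" and h_r: "\<And>x. x \<in> K \<Longrightarrow> h (r x) = x"
    and r: "r ` K = Y" "continuous_on K r"
    by (auto simp: homeomorphism_def)
  have "compact K"
    unfolding K_def using \<open>compact Y\<close> h(1) by (rule compact_continuous_image[rotated])
  then have "closed K" and K_borel [measurable]: "K \<in> sets borel"
    by (auto intro: compact_imp_closed borel_closed)
  have "K \<noteq> {}"
    using w by (auto simp: K_def)
  have orbit: "(T ^^ k) w \<in> Y" for k
    using T(2) w by (rule funpow_mem_invariant)
  have K_orbit: "h ((T ^^ k) w) \<in> K" for k
    using orbit by (simp add: K_def)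

  \<comment> \<open>Tietze transports continuous functions on \<open>Y\<close> to bounded continuous functions on the line,
    the test functions of weak convergence.\<close>
  have extend: "\<exists>\<psi> B. (\<forall>x. isCont \<psi> x) \<and> (\<forall>x. norm (\<psi> x) \<le> B) \<and> (\<forall>y\<in>Y. \<psi> (h y) = \<phi> y)"
    if "continuous_on Y \<phi>" for \<phi> :: "'a \<Rightarrow> 'b::euclidean_space"
  proof -
    have cont: "continuous_on K (\<lambda>x. \<phi> (r x))"
      using continuous_on_compose2[OF that r(2)] r(1) by simp
    then have "bounded ((\<lambda>x. \<phi> (r x)) ` K)"
      using \<open>compact K\<close> by (intro compact_imp_bounded compact_continuous_image)
    then obtain B where B: "\<And>x. x \<in> K \<Longrightarrow> norm (\<phi> (r x)) \<le> B"
      unfolding bounded_iff by blast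
    with \<open>K \<noteq> {}\<close> have "0 \<le> B"
      by (meson all_not_in_conv norm_ge_zero order_trans)
    obtain \<psi> where "continuous_on UNIV \<psi>" "\<And>x. x \<in> K \<Longrightarrow> \<psi> x = \<phi> (r x)"
      "\<And>x. norm (\<psi> x) \<le> B"
      using Tietze[OF cont _ \<open>0 \<le> B\<close> B, of UNIV] \<open>closed K\<close> by auto
    then show ?thesis
      by (intro exI[of _ \<psi>] exI[of _ B])
        (auto simp: continuous_on_eq_continuous_at r_h K_def)
  qed

  \<comment> \<open>The \<open>n + 1\<close> points of index up to \<open>n\<close> are used, so
    that \<open>emp n\<close> is a probability measure even for \<open>n = 0\<close>.\<close>
  define emp where
    "emp n = distr (uniform_count_measure {..n}) borel (\<lambda>k. h ((T ^^ k) w))" for n :: nat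
  have meas [measurable]: "(\<lambda>k. \<phi> k) \<in> uniform_count_measure {..n} \<rightarrow>\<^sub>M borel"
    for \<phi> :: "nat \<Rightarrow> 'c::topological_space" and n
    by (simp add: measurable_def space_uniform_count_measure sets_uniform_count_measure)
  have emp_dist: "real_distribution (emp n)" for n
    unfolding emp_def by (intro prob_space.real_distribution_distr prob_space_uniform_count_measure meas) auto
  have emp_integral: "integral\<^sup>L (emp n) \<phi> = (\<Sum>k\<le>n. \<phi> (h ((T ^^ k) w))) /\<^sub>R real (Suc n)"
    if [measurable]: "\<phi> \<in> borel_measurable borel"
    for \<phi> :: "real \<Rightarrow> 'b::{banach, second_countable_topology}" and n
  proof -
    have "integral\<^sup>L (emp n) \<phi> = (\<integral>k. \<phi> (h ((T ^^ k) w)) \<partial>uniform_count_measure {..n})"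
      unfolding emp_def by (rule integral_distr) measurable
    also have "\<dots> = (\<Sum>k\<le>n. (1 / real (Suc n)) *\<^sub>R \<phi> (h ((T ^^ k) w)))"
      unfolding uniform_count_measure_def by (subst lebesgue_integral_point_measure_finite) auto
    finally show ?thesis
      by (simp add: scaleR_sum_right divide_inverse)
  qed
  \<comment> \<open>All points \<open>h ((T ^^ k) w)\<close> lie in the compact set
    \<open>K\<close>, so one bounded interval carries the whole mass of every
    \<open>emp n\<close>.\<close>
  have "tight emp"
  proof -
    obtain b where b: "b > 0" "\<And>x. x \<in> K \<Longrightarrow> \<bar>x\<bar> < b"
      using compact_imp_bounded[OF \<open>compact K\<close>] unfolding bounded_pos_less by auto
    have "measure (emp n) {-b<..b} = 1" for n
    proof -
      have "(\<lambda>k. h ((T ^^ k) w)) -` {-b<..b} \<inter> {..n} = {..n}"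
        using b(2)[OF K_orbit] by (auto simp: abs_less_iff minus_less_iff less_imp_le)
      then show ?thesis
        unfolding emp_def by (subst measure_distr[OF meas])
          (auto simp: space_uniform_count_measure measure_uniform_count_measure)
    qed
    then show ?thesis
      unfolding tight_def using emp_dist b(1)
      by (intro conjI allI impI exI[of _ "-b"] exI[of _ b]) auto
  qed

  from ue obtain \<mu> where \<mu>: "invariant_borel_prob Y T \<mu>"
    and \<mu>_unique: "\<And>\<kappa>. invariant_borel_prob Y T \<kappa> \<Longrightarrow> \<kappa> = \<mu>"
    unfolding uniquely_ergodic_subsystem_def by blast
  have h_meas: "h \<in> borel_measurable (restrict_space borel Y)"
    using h(1) by (rule borel_measurable_continuous_on_restrict)
  have T_meas: "T \<in> restrict_space borel Y \<rightarrow>\<^sub>M restrict_space borel Y"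
    using T by (intro measurable_restrict_space2 borel_measurable_continuous_on_restrict)
      (auto simp: space_restrict_space)
  \<comment> \<open>Extends the inverse of \<open>h\<close> to a Borel map from the whole line into
    \<open>Y\<close>. The value \<open>w\<close> off \<open>K\<close> is a filler: the limit
    measures are carried by \<open>K\<close>.\<close>
  define r' where "r' x = (if x \<in> K then r x else w)" for x
  have r'_meas: "r' \<in> borel \<rightarrow>\<^sub>M restrict_space borel Y"
  proof (rule measurable_restrict_space2)
    show "r' \<in> space borel \<rightarrow> Y"
      using r(1) w by (auto simp: r'_def)
    have "r \<in> borel_measurable (restrict_space borel K)"
      using r(2) by (rule borel_measurable_continuous_on_restrict)
    then show "r' \<in> borel_measurable borel"
      unfolding r'_def using K_borel by (subst measurable_If_restrict_space_iff) auto
  qed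
  have r'_h: "r' (h y) = y" if "y \<in> Y" for y
    using that by (auto simp: r'_def K_def r_h)

  define M where "M = distr \<mu> borel h"
  have \<mu>_sets: "sets \<mu> = sets (restrict_space borel Y)" and "prob_space \<mu>"
    using \<mu> by (auto simp: invariant_borel_prob_def)
  have M_dist: "real_distribution M"
    unfolding M_def using \<open>prob_space \<mu>\<close> h_meas
    by (intro prob_space.real_distribution_distr) (auto cong: measurable_cong_sets[OF \<mu>_sets])

  \<comment> \<open>A subsequential limit \<open>\<nu>\<close> is carried by \<open>K\<close> and
    pulls back to a measure \<open>\<kappa>\<close> on \<open>Y\<close>. Invariance forces
    \<open>\<kappa> = \<mu>\<close> and thereby \<open>\<nu> = M\<close>.\<close>
  have limit: "\<nu> = M" if s: "strict_mono s" and \<nu>: "real_distribution \<nu>"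
    and conv: "weak_conv_m (emp \<circ> s) \<nu>" for s \<nu>
  proof -
    interpret \<nu>: real_distribution \<nu> by fact
    have lim: "(\<lambda>n. integral\<^sup>L (emp (s n)) \<phi>) \<longlonglongrightarrow> integral\<^sup>L \<nu> \<phi>"
      if "\<And>x. isCont \<phi> x" "\<And>x. norm (\<phi> x) \<le> B"
      for \<phi> :: "real \<Rightarrow> 'b::{banach, second_countable_topology}" and B
      using weak_conv_imp_integral_bdd_continuous_conv[OF _ \<nu> conv that] emp_dist by simp
    have cont_meas: "\<phi> \<in> borel_measurable borel" if "\<And>x. isCont \<phi> x"
      for \<phi> :: "real \<Rightarrow> 'b::{banach, second_countable_topology}"
      using that by (intro borel_measurable_continuous_onI) (simp add: continuous_on_eq_continuous_at)
    have supp: "AE x in \<nu>. x \<in> K"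
    proof -
      \<comment> \<open>A bounded continuous test function that vanishes exactly on
        \<open>K\<close>; its integral is zero for each \<open>emp (s n)\<close>, hence for
        \<open>\<nu>\<close>.\<close>
      let ?\<phi> = "\<lambda>x. min 1 (infdist x K)"
      have c: "isCont ?\<phi> x" for x
        by (intro continuous_intros)
      have b: "norm (?\<phi> x) \<le> 1" for x
        by (simp add: infdist_nonneg)
      have "integral\<^sup>L (emp (s n)) ?\<phi> = 0" for n
        using orbit by (subst emp_integral[OF cont_meas[OF c]]) (simp add: K_def)
      with lim[OF c b] have "integral\<^sup>L \<nu> ?\<phi> = 0"
        by (simp add: LIMSEQ_const_iff)
      moreover have "integrable \<nu> ?\<phi>"
        using b cont_meas[OF c] by (intro \<nu>.integrable_const_bound[where B = 1]) auto
      ultimately have "AE x in \<nu>. ?\<phi> x = 0"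
        by (subst (asm) integral_nonneg_eq_0_iff_AE) (auto simp: infdist_nonneg)
      then show ?thesis
        using in_closed_iff_infdist_zero[OF \<open>closed K\<close> \<open>K \<noteq> {}\<close>]
        by (auto simp: min_def split: if_splits elim!: AE_mp)
    qed
    define \<kappa> where "\<kappa> = distr \<nu> (restrict_space borel Y) r'"
    have r'_meas\<nu>: "r' \<in> \<nu> \<rightarrow>\<^sub>M restrict_space borel Y"
      using r'_meas by simp
    have \<kappa>_sets: "sets \<kappa> = sets (restrict_space borel Y)"
      by (simp add: \<kappa>_def)
    have space_\<kappa>: "space \<kappa> = Y"
      by (simp add: \<kappa>_def space_restrict_space)
    interpret \<kappa>: prob_space \<kappa>
      unfolding \<kappa>_def using r'_meas\<nu> by (rule \<nu>.prob_space_distr)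
    note \<kappa>_cong = measurable_cong_sets[OF \<kappa>_sets refl] measurable_cong_sets[OF refl \<kappa>_sets]
    have hT_meas: "(\<lambda>y. h (T y)) \<in> borel_measurable (restrict_space borel Y)"
      using measurable_compose[OF T_meas h_meas] .
    have \<nu>_eq: "distr \<kappa> borel h = \<nu>"
    proof -
      have "distr \<kappa> borel h = distr \<nu> borel (\<lambda>x. h (r' x))"
        unfolding \<kappa>_def using distr_distr[OF h_meas r'_meas\<nu>] by (simp add: comp_def)
      also have "\<dots> = distr \<nu> borel (\<lambda>x. x)"
        using supp measurable_compose[OF r'_meas\<nu> h_meas]
        by (intro distr_cong_AE) (auto simp: r'_def h_r elim!: AE_mp)
      finally show ?thesis
        by (simp add: distr_id2)
    qed
    \<comment> \<open>Invariance is first shown for laws on the line, where characteristic functions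
      decide equality, so only exponentials have to be tested.\<close>
    have "distr \<kappa> borel (\<lambda>y. h (T y)) = distr \<kappa> borel h"
    proof (rule Levy_uniqueness)
      show "real_distribution (distr \<kappa> borel (\<lambda>y. h (T y)))" "real_distribution (distr \<kappa> borel h)"
        using hT_meas h_meas by (auto intro!: \<kappa>.real_distribution_distr simp: \<kappa>_cong)
      show "char (distr \<kappa> borel (\<lambda>y. h (T y))) = char (distr \<kappa> borel h)"
      proof
        fix t
        let ?e = "\<lambda>x. iexp (t * x)"
        have e_cont: "isCont ?e x" for x
          by (intro continuous_intros)
        have e_bound: "norm (?e x) \<le> 1" for x
          by simp
        have e_meas: "?e \<in> borel_measurable borel"
          by (rule cont_meas[OF e_cont])
        have "continuous_on Y (\<lambda>y. ?e (h (T y)))"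
          by (intro continuous_intros continuous_on_compose2[OF h(1) T(1)] T(2))
        then obtain \<psi> B where \<psi>: "\<And>x. isCont \<psi> x" "\<And>x. norm (\<psi> x) \<le> B"
          "\<And>y. y \<in> Y \<Longrightarrow> \<psi> (h y) = ?e (h (T y))"
          using extend by blast
        \<comment> \<open>Since \<open>\<psi> (h y)\<close> equals \<open>?e (h (T y))\<close> on
          \<open>Y\<close>, the difference of the integrals telescopes along the orbit to two end
          terms of modulus one, divided by \<open>n + 1\<close>.\<close>
        let ?d = "\<lambda>n. (?e (h ((T ^^ Suc n) w)) - ?e (h w)) /\<^sub>R real (Suc n)"
        have d: "integral\<^sup>L (emp n) \<psi> - integral\<^sup>L (emp n) ?e = ?d n" for n
        proof -
          have "(\<Sum>k\<le>n. \<psi> (h ((T ^^ k) w))) - (\<Sum>k\<le>n. ?e (h ((T ^^ k) w)))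
            = (\<Sum>k\<le>n. ?e (h ((T ^^ Suc k) w)) - ?e (h ((T ^^ k) w)))"
            using orbit by (simp add: \<psi>(3) sum_subtractf)
          also have "\<dots> = ?e (h ((T ^^ Suc n) w)) - ?e (h w)"
            using sum_lessThan_telescope[of "\<lambda>k. ?e (h ((T ^^ k) w))" "Suc n"]
            by (simp only: lessThan_Suc_atMost funpow_0)
          finally show ?thesis
            by (subst (1 2) emp_integral) (auto simp: e_meas cont_meas \<psi>(1) scaleR_diff_right[symmetric])
        qed
        have "?d \<longlonglongrightarrow> 0"
        proof (rule Lim_null_comparison)
          have "norm (?e (h ((T ^^ Suc n) w)) - ?e (h w)) \<le> 2" for n
            by (rule order_trans[OF norm_triangle_ineq4]) simp
          then show "\<forall>\<^sub>F n in sequentially. norm (?d n) \<le> 2 * inverse (real (Suc n))"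
            by (auto simp: divide_simps simp del: funpow.simps)
          show "(\<lambda>n. 2 * inverse (real (Suc n))) \<longlonglongrightarrow> 0"
            by (intro tendsto_mult_right_zero LIMSEQ_inverse_real_of_nat)
        qed
        then have "(\<lambda>n. integral\<^sup>L (emp (s n)) \<psi> - integral\<^sup>L (emp (s n)) ?e) \<longlonglongrightarrow> 0"
          unfolding d using LIMSEQ_subseq_LIMSEQ[OF _ s] by (simp add: comp_def)
        moreover have "(\<lambda>n. integral\<^sup>L (emp (s n)) \<psi> - integral\<^sup>L (emp (s n)) ?e)
            \<longlonglongrightarrow> integral\<^sup>L \<nu> \<psi> - integral\<^sup>L \<nu> ?e"
          by (intro tendsto_diff lim[OF \<psi>(1,2)] lim[OF e_cont e_bound])
        ultimately have "integral\<^sup>L \<nu> \<psi> = integral\<^sup>L \<nu> ?e"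
          using LIMSEQ_unique by fastforce
        moreover have "integral\<^sup>L \<nu> \<psi> = char (distr \<kappa> borel (\<lambda>y. h (T y))) t"
        proof -
          have "integral\<^sup>L \<nu> \<psi> = (\<integral>y. \<psi> (h y) \<partial>\<kappa>)"
            by (subst \<nu>_eq[symmetric], rule integral_distr)
              (auto simp: \<kappa>_cong h_meas cont_meas \<psi>(1))
          also have "\<dots> = (\<integral>y. ?e (h (T y)) \<partial>\<kappa>)"
            by (intro Bochner_Integration.integral_cong) (auto simp: space_\<kappa> \<psi>(3))
          also have "\<dots> = char (distr \<kappa> borel (\<lambda>y. h (T y))) t"
            unfolding char_def by (rule integral_distr[symmetric]) (auto simp: \<kappa>_cong hT_meas e_meas)
          finally show ?thesis .
        qed
        ultimately show "char (distr \<kappa> borel (\<lambda>y. h (T y))) t = char (distr \<kappa> borel h) t"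
          by (simp add: \<nu>_eq char_def)
      qed
    qed
    then have eq: "emeasure \<kappa> ((\<lambda>y. h (T y)) -` C \<inter> Y) = emeasure \<kappa> (h -` C \<inter> Y)" if "C \<in> sets borel" for C
      using that hT_meas h_meas
      by (metis (no_types, lifting) \<kappa>_cong(1) emeasure_distr space_\<kappa>)
    have "emeasure \<kappa> (T -` B \<inter> Y) = emeasure \<kappa> B" if B: "B \<in> sets \<kappa>" for B
    proof -
      \<comment> \<open>Injectivity of \<open>h\<close> enters here: \<open>B\<close> is the
        preimage in \<open>Y\<close> under \<open>h\<close> of the Borel set \<open>C\<close>, so
        equality of the laws on the line gives invariance of \<open>\<kappa>\<close>.\<close>
      define C where "C = r' -` B"
      have "C \<in> sets borel"
        using measurable_sets[OF r'_meas, of B] B by (simp add: C_def \<kappa>_sets)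
      moreover have "(\<lambda>y. h (T y)) -` C \<inter> Y = T -` B \<inter> Y"
        using T(2) by (auto simp: C_def r'_h image_subset_iff)
      moreover have "h -` C \<inter> Y = B"
        using sets.sets_into_space[OF B] by (auto simp: C_def r'_h space_\<kappa>)
      ultimately show ?thesis
        using eq by metis
    qed
    then have "invariant_borel_prob Y T \<kappa>"
      unfolding invariant_borel_prob_def space_\<kappa> using \<kappa>_sets \<kappa>.prob_space_axioms by blast
    then show ?thesis
      using \<nu>_eq \<mu>_unique by (auto simp: M_def)
  qed
  \<comment> \<open>A tight sequence whose weakly convergent subsequences all have the limit
    \<open>M\<close> converges to \<open>M\<close> itself.\<close>
  have conv: "weak_conv_m emp M"
    using emp_dist M_dist \<open>tight emp\<close>
  proof (rule tight_subseq_weak_converge)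
    show "weak_conv_m (emp \<circ> s) M"
      if "strict_mono s" "real_distribution \<nu>" "weak_conv_m (emp \<circ> s) \<nu>" for s \<nu>
      using limit[OF that] that(3) by simp
  qed
  obtain \<psi> B where \<psi>: "\<And>x. isCont \<psi> x" "\<And>x. norm (\<psi> x) \<le> B" "\<And>y. y \<in> Y \<Longrightarrow> \<psi> (h y) = g y"
    using extend[OF g] by blast
  have "\<psi> \<in> borel_measurable borel"
    using \<psi>(1) by (intro borel_measurable_continuous_onI) (simp add: continuous_on_eq_continuous_at)
  then have "integral\<^sup>L (emp n) \<psi> = (\<Sum>k\<le>n. g ((T ^^ k) w)) / real (Suc n)" for n
    using orbit by (simp add: emp_integral \<psi>(3) divide_inverse mult.commute)
  moreover have "(\<lambda>n. integral\<^sup>L (emp n) \<psi>) \<longlonglongrightarrow> integral\<^sup>L M \<psi>"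
    using weak_conv_imp_integral_bdd_continuous_conv[OF emp_dist M_dist conv \<psi>(1,2)] .
  ultimately show ?thesis
    by (auto simp: convergent_def)
qed

subsection \<open>Functions of bounded variation\<close>

text \<open>Finiteness of the series makes each variation finite, hence a real number. The index is
  shifted: \<open>v n\<close> belongs to agreement on the \<open>n + 1\<close> coordinates
  \<open>0\<close> to \<open>n\<close>.\<close>

lemma bounded_variation_modulus:
  assumes "bounded_variation_fun f"
  obtains v :: "nat \<Rightarrow> real" where "\<And>n. 0 \<le> v n" "summable v"
    "\<And>n x y. \<forall>k\<le>n. x k = y k \<Longrightarrow> \<bar>f x - f y\<bar> \<le> v n"
proof
  let ?v = "\<lambda>n. enn2real (variation (Suc n) f)"
  have fin: "(\<Sum>n. variation (Suc n) f) < top"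
    using assms by (simp add: bounded_variation_fun_def)
  have v: "ennreal (?v n) = variation (Suc n) f" for n
  proof -
    have "variation (Suc n) f \<le> (\<Sum>n. variation (Suc n) f)"
      using sum_le_suminf[OF summableI, of "{n}" "\<lambda>n. variation (Suc n) f"] by simp
    then show ?thesis
      using fin by (simp add: order_le_less_trans)
  qed
  show "0 \<le> ?v n" for n
    by simp
  show "summable ?v"
    using fin by (intro summable_suminf_not_top) (simp_all only: v, auto)
  show "\<bar>f x - f y\<bar> \<le> ?v n" if "\<forall>k\<le>n. x k = y k" for n x y
  proof -
    have "ennreal \<bar>f x - f y\<bar> \<le> variation (Suc n) f"
      unfolding variation_def using that by (intro SUP_upper2[of "(x, y)"]) auto
    then have "ennreal \<bar>f x - f y\<bar> \<le> ennreal (?v n)"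
      by (simp only: v)
    then show ?thesis
      by (simp add: ennreal_le_iff)
  qed
qed

text \<open>After \<open>k\<close> shifts the points still agree on \<open>n - k\<close>
  coordinates, so term \<open>k\<close> costs at most \<open>W * v (n - Suc k)\<close>. Reversing
  the sum bounds the total by the full series, uniformly in \<open>n\<close>.\<close>

lemma weighted_birkhoff_distortion:
  fixes v :: "nat \<Rightarrow> real"
  assumes v: "\<And>n. 0 \<le> v n" "summable v"
    and f: "\<And>n x y. \<forall>k\<le>n. x k = y k \<Longrightarrow> \<bar>f x - f y\<bar> \<le> v n"
    and u: "\<And>k. \<bar>u k\<bar> \<le> W" and xy: "\<forall>k<n. x k = y k"
  shows "(\<Sum>k<n. \<bar>u k * f ((seq_shift ^^ k) x) - u k * f ((seq_shift ^^ k) y)\<bar>) \<le> W * suminf v"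
proof -
  have "W \<ge> 0"
    using u[of 0] by linarith
  have "(\<Sum>k<n. \<bar>u k * f ((seq_shift ^^ k) x) - u k * f ((seq_shift ^^ k) y)\<bar>)
      \<le> (\<Sum>k<n. W * v (n - Suc k))"
  proof (rule sum_mono)
    fix k assume "k \<in> {..<n}"
    then have "\<bar>f ((seq_shift ^^ k) x) - f ((seq_shift ^^ k) y)\<bar> \<le> v (n - Suc k)"
      using xy by (intro f) (auto simp: seq_shift_funpow)
    then show "\<bar>u k * f ((seq_shift ^^ k) x) - u k * f ((seq_shift ^^ k) y)\<bar> \<le> W * v (n - Suc k)"
      unfolding right_diff_distrib[symmetric] abs_mult using u[of k] by (intro mult_mono) auto
  qed
  also have "\<dots> = W * (\<Sum>k<n. v k)"
    using sum.nat_diff_reindex[of v n] by (simp add: sum_distrib_left[symmetric])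
  also have "\<dots> \<le> W * suminf v"
    using \<open>W \<ge> 0\<close> v by (intro mult_left_mono sum_le_suminf) auto
  finally show ?thesis .
qed

text \<open>The value at any point is within \<open>v 0\<close> of the value at the constant
  sequence of its first letter, and there are finitely many letters.\<close>

lemma bounded_variation_bounded:
  fixes f :: "(nat \<Rightarrow> 's::finite) \<Rightarrow> real"
  assumes "bounded_variation_fun f"
  obtains B where "\<And>x. \<bar>f x\<bar> \<le> B"
proof -
  obtain v where v: "\<And>n. 0 \<le> v n" "summable v"
    "\<And>n x y. \<forall>k\<le>n. x k = y k \<Longrightarrow> \<bar>f x - f y\<bar> \<le> v n"
    using bounded_variation_modulus[OF assms] by metis
  show ?thesis
  proof
    fix x
    have "\<bar>f x - f (\<lambda>_. x 0)\<bar> \<le> v 0"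
      by (rule v(3)) simp
    moreover have "\<bar>f (\<lambda>_. x 0)\<bar> \<le> Max (range (\<lambda>s. \<bar>f (\<lambda>_. s)\<bar>))"
      by (rule Max_ge) auto
    ultimately show "\<bar>f x\<bar> \<le> v 0 + Max (range (\<lambda>s. \<bar>f (\<lambda>_. s)\<bar>))"
      by linarith
  qed
qed

section \<open>Measurability for the Bernoulli measure\<close>

lemma space_uniform_bernoulli: "space uniform_bernoulli = UNIV"
  by (simp add: uniform_bernoulli_def space_PiM space_uniform_count_measure)

text \<open>A set outside the sigma-algebra has \<open>emeasure\<close> zero by convention, whereas
  the cylinder formula gives a positive value.\<close>

lemma sets_cylinder: "{y. \<forall>k<n. y k = x k} \<in> sets (uniform_bernoulli :: (nat \<Rightarrow> 's::finite) measure)"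
proof (rule ccontr)
  assume "\<not> ?thesis"
  then have "emeasure uniform_bernoulli {y. \<forall>k<n. y k = x k} = 0"
    by (rule emeasure_notin_sets)
  moreover have "real CARD('s) ^ n > 0"
    by simp
  ultimately show False
    by (simp add: emeasure_uniform_bernoulli_cylinder ennreal_eq_0_iff flip: not_less)
qed

lemma measurable_funpow_seq_shift:
  "(seq_shift ^^ k) \<in> uniform_bernoulli \<rightarrow>\<^sub>M (uniform_bernoulli :: (nat \<Rightarrow> 's::finite) measure)"
  unfolding uniform_bernoulli_def seq_shift_funpow[abs_def]
  by (rule measurable_PiM_single') (auto simp: space_PiM intro: measurable_component_singleton)

text \<open>\<open>f\<close> is the limit of its values at truncated points: agreement on
  \<open>Suc n\<close> coordinates costs at most \<open>v n\<close>, which tends to zero.\<close>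

lemma borel_measurable_bounded_variation:
  fixes f :: "(nat \<Rightarrow> 's::finite) \<Rightarrow> real"
  assumes "bounded_variation_fun f"
  shows "f \<in> borel_measurable uniform_bernoulli"
proof -
  obtain v where v: "\<And>n. 0 \<le> v n" "summable v"
    "\<And>n x y. \<forall>k\<le>n. x k = y k \<Longrightarrow> \<bar>f x - f y\<bar> \<le> v n"
    using bounded_variation_modulus[OF assms] by metis
  \<comment> \<open>The fixed letter \<open>undefined\<close> overwrites all coordinates from
    \<open>n\<close> on, so \<open>P n\<close> has finite range and its fibres are
    cylinders.\<close>
  define P where "P n x = (\<lambda>k. if k < n then x k else undefined)" for n and x :: "nat \<Rightarrow> 's"
  have P_eq: "P m y = P m x \<longleftrightarrow> (\<forall>k<m. y k = x k)" for m x y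
    unfolding P_def fun_eq_iff by auto
  show ?thesis
  proof (rule borel_measurable_LIMSEQ_real)
    show "(\<lambda>x. f (P (Suc n) x)) \<in> borel_measurable uniform_bernoulli" for n
    proof -
      let ?m = "Suc n"
      have fin: "finite (range (P ?m))"
      proof (rule finite_subset)
        show "range (P ?m) \<subseteq> {..<?m} \<rightarrow>\<^sub>E UNIV"
          by (auto simp: P_def split: if_splits)
      qed (simp add: finite_PiE)
      have "P ?m -` {a} \<in> sets uniform_bernoulli" if "a \<in> range (P ?m)" for a
      proof -
        from that obtain x where a: "a = P ?m x"
          by blast
        have "P ?m -` {a} = {y. \<forall>k<?m. y k = x k}"
          unfolding a by (auto simp: P_eq)
        then show ?thesis
          by (simp add: sets_cylinder)
      qed
      then have "P ?m \<in> uniform_bernoulli \<rightarrow>\<^sub>M count_space (range (P ?m))"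
        using fin by (subst measurable_count_space_eq2) (auto simp: space_uniform_bernoulli)
      then show ?thesis
        by (rule measurable_compose) simp
    qed
    show "(\<lambda>n. f (P (Suc n) x)) \<longlonglongrightarrow> f x" for x
    proof (rule LIM_zero_cancel, rule Lim_null_comparison)
      show "\<forall>\<^sub>F n in sequentially. norm (f (P (Suc n) x) - f x) \<le> v n"
        by (intro always_eventually allI, simp only: real_norm_def, rule v(3)) (auto simp: P_def)
      show "v \<longlonglongrightarrow> 0"
        using v(2) by (rule summable_LIMSEQ_zero)
    qed
  qed
qed

section \<open>Exponential moments of bounded random variables\<close>

lemma (in prob_space) integrable_exp_bounded:
  fixes H :: "'a \<Rightarrow> real"
  assumes [measurable]: "H \<in> borel_measurable M" and H: "\<And>x. \<bar>H x\<bar> \<le> B"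
  shows "integrable M (\<lambda>x. exp (H x))" "0 < expectation (\<lambda>x. exp (H x))"
proof -
  show i: "integrable M (\<lambda>x. exp (H x))"
    using H by (intro integrable_const_bound[where B = "exp B"]) (auto simp: abs_le_iff)
  have "exp (- B) = expectation (\<lambda>x. exp (- B))"
    by (simp add: prob_space)
  also have "\<dots> \<le> expectation (\<lambda>x. exp (H x))"
    using H by (intro integral_mono i) (auto simp: abs_le_iff minus_le_iff)
  finally show "0 < expectation (\<lambda>x. exp (H x))"
    by (rule less_le_trans[rotated]) simp
qed

text \<open>A pointwise gap \<open>c\<close> becomes a factor \<open>exp c\<close> between the
  expectations, hence an additive \<open>c\<close> after \<open>ln\<close>. The bounds
  \<open>B\<close> and \<open>B'\<close> provide integrability and positivity.\<close>

lemma (in prob_space) abs_ln_expectation_exp_diff_le: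
  fixes F G :: "'a \<Rightarrow> real"
  assumes [measurable]: "F \<in> borel_measurable M" "G \<in> borel_measurable M"
    and F: "\<And>x. \<bar>F x\<bar> \<le> B" and G: "\<And>x. \<bar>G x\<bar> \<le> B'" and FG: "\<And>x. \<bar>F x - G x\<bar> \<le> c"
  shows "\<bar>ln (expectation (\<lambda>x. exp (F x))) - ln (expectation (\<lambda>x. exp (G x)))\<bar> \<le> c"
proof -
  note int = integrable_exp_bounded
  have le: "ln (expectation (\<lambda>x. exp (H x))) \<le> ln (expectation (\<lambda>x. exp (H' x))) + c"
    if H: "H \<in> borel_measurable M" "\<And>x. \<bar>H x\<bar> \<le> b"
      and H': "H' \<in> borel_measurable M" "\<And>x. \<bar>H' x\<bar> \<le> b'"
      and HH': "\<And>x. H x \<le> H' x + c" for H H' :: "'a \<Rightarrow> real" and b b'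
  proof -
    have "expectation (\<lambda>x. exp (H x)) \<le> expectation (\<lambda>x. exp (H' x) * exp c)"
      using HH' by (intro integral_mono int[OF H] integrable_mult_left int[OF H'])
        (simp add: exp_add[symmetric])
    also have "\<dots> = expectation (\<lambda>x. exp (H' x)) * exp c"
      by simp
    finally have "ln (expectation (\<lambda>x. exp (H x))) \<le> ln (expectation (\<lambda>x. exp (H' x)) * exp c)"
      using int(2)[OF H] by (simp add: ln_mono)
    then show ?thesis
      using int(2)[OF H'] by (simp add: ln_mult)
  qed
  have "F x \<le> G x + c" "G x \<le> F x + c" for x
    using FG[of x] by (auto simp: abs_le_iff)
  then show ?thesis
    using le[OF assms(1) F assms(2) G] le[OF assms(2) G assms(1) F] by fastforce
qed

subsection \<open>Almost additive cocycles\<close>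

lemma convergent_approximable:
  fixes x :: "nat \<Rightarrow> real"
  assumes "\<And>\<epsilon>. \<epsilon> > 0 \<Longrightarrow> \<exists>y. convergent y \<and> (\<forall>\<^sub>F n in sequentially. \<bar>x n - y n\<bar> < \<epsilon>)"
  shows "convergent x"
  unfolding Cauchy_convergent_iff[symmetric]
proof (rule metric_CauchyI)
  fix \<epsilon> :: real assume "\<epsilon> > 0"
  then obtain y where "convergent y" and "\<forall>\<^sub>F n in sequentially. \<bar>x n - y n\<bar> < \<epsilon> / 3"
    using assms[of "\<epsilon> / 3"] by auto
  then obtain N where N: "\<And>n. n \<ge> N \<Longrightarrow> \<bar>x n - y n\<bar> < \<epsilon> / 3"
    by (auto simp: eventually_sequentially)
  obtain N' where N': "\<And>n m. n \<ge> N' \<Longrightarrow> m \<ge> N' \<Longrightarrow> dist (y n) (y m) < \<epsilon> / 3"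
    using metric_CauchyD[of y "\<epsilon> / 3"] \<open>convergent y\<close> \<open>\<epsilon> > 0\<close>
    by (auto simp: Cauchy_convergent_iff)
  have "dist (x n) (x m) < \<epsilon>" if "n \<ge> max N N'" "m \<ge> max N N'" for n m
  proof -
    have "\<bar>x n - y n\<bar> < \<epsilon> / 3" "\<bar>x m - y m\<bar> < \<epsilon> / 3" "\<bar>y n - y m\<bar> < \<epsilon> / 3"
      using N[of n] N[of m] N'[of n m] that by (auto simp: dist_real_def)
    then show ?thesis
      unfolding dist_real_def by linarith
  qed
  then show "\<exists>M. \<forall>m\<ge>M. \<forall>n\<ge>M. dist (x m) (x n) < \<epsilon>"
    by blast
qed

text \<open>\<open>b k m\<close> stands for the log-integral of length \<open>m\<close> started at
  time \<open>k\<close>. A large \<open>m\<close> makes the error \<open>C / m\<close> small; for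
  this \<open>m\<close> the sequence follows the averages of \<open>b k m\<close>, divided by
  \<open>m\<close>, up to \<open>R / n\<close>.\<close>

lemma almost_additive_convergent:
  fixes b :: "nat \<Rightarrow> nat \<Rightarrow> real"
  assumes add: "\<And>n m. \<bar>b 0 (n + m) - (b 0 n + b n m)\<bar> \<le> C"
    and bound: "\<And>n m. \<bar>b n m\<bar> \<le> L * real m"
    and avg: "\<And>m. convergent (\<lambda>n. (\<Sum>k\<le>n. b k m) / real (Suc n))"
  shows "convergent (\<lambda>n. b 0 n / real n)"
proof (rule convergent_approximable)
  fix \<epsilon> :: real assume \<epsilon>: "\<epsilon> > 0"
  obtain m :: nat where m: "m > 0" "C / real m < \<epsilon> / 2"
  proof -
    obtain m :: nat where m: "real m > \<bar>2 * C / \<epsilon>\<bar>"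
      using reals_Archimedean2 by blast
    then have "real m > 0"
      by linarith
    then have "m > 0"
      by simp
    moreover have "C / real m < \<epsilon> / 2"
      using m \<epsilon> \<open>m > 0\<close> by (auto simp: field_simps abs_less_iff)
    ultimately show thesis
      by (rule that)
  qed
  \<comment> \<open>Bounds \<open>b 0 (n + i) - b 0 i - b 0 n\<close> for \<open>i < m\<close>: the
    additivity defect \<open>C\<close>, plus \<open>L * real m\<close> for each of
    \<open>b n i\<close> and \<open>b 0 i\<close>.\<close>
  define R where "R = C + 2 * L * real m"
  have "L \<ge> 0"
    using bound[of 0 1] by simp
  \<comment> \<open>Sum the almost additivity estimate over the starting points \<open>k < n\<close>: the left-hand sides
    telescope to a sum of \<open>m\<close> terms, each close to \<open>b 0 n\<close>.\<close>
  have main: "\<bar>real m * b 0 n - (\<Sum>k<n. b k m)\<bar> \<le> real n * C + real m * R" for n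
  proof -
    define D where "D k = (\<Sum>i<m. b 0 (k + i))" for k
    have D_Suc: "D (Suc k) - D k = b 0 (k + m) - b 0 k" for k
    proof -
      have "D (Suc k) - D k = (\<Sum>i<m. b 0 (k + Suc i) - b 0 (k + i))"
        by (simp add: D_def sum_subtractf)
      also have "\<dots> = b 0 (k + m) - b 0 k"
        using sum_lessThan_telescope[of "\<lambda>i. b 0 (k + i)" m] by simp
      finally show ?thesis .
    qed
    have "D n - D 0 - (\<Sum>k<n. b k m) = (\<Sum>k<n. b 0 (k + m) - (b 0 k + b k m))"
      using sum_lessThan_telescope[of D n]
      by (simp add: D_Suc sum_subtractf sum.distrib)
    also have "\<bar>\<dots>\<bar> \<le> (\<Sum>k<n. C)"
      by (rule order_trans[OF sum_abs sum_mono]) (rule add)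
    finally have 1: "\<bar>D n - D 0 - (\<Sum>k<n. b k m)\<bar> \<le> real n * C"
      by simp
    have "D n - D 0 - real m * b 0 n = (\<Sum>i<m. b 0 (n + i) - b 0 i - b 0 n)"
      by (simp add: D_def sum_subtractf)
    also have "\<bar>\<dots>\<bar> \<le> (\<Sum>i<m. R)"
    proof (rule order_trans[OF sum_abs sum_mono])
      fix i assume "i \<in> {..<m}"
      then have "L * real i \<le> L * real m"
        using \<open>L \<ge> 0\<close> by (intro mult_left_mono) auto
      then show "\<bar>b 0 (n + i) - b 0 i - b 0 n\<bar> \<le> R"
        unfolding R_def using add[of n i] bound[of n i] bound[of 0 i] by linarith
    qed
    finally have "\<bar>D n - D 0 - real m * b 0 n\<bar> \<le> real m * R"
      by simp
    with 1 show ?thesis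
      by linarith
  qed
  define y where "y n = (\<Sum>k<n. b k m) / real n / real m" for n
  have "convergent (\<lambda>n. y (Suc n))"
    unfolding y_def lessThan_Suc_atMost by (intro convergent_mult avg convergent_const | subst divide_inverse)+
  then have "convergent y"
    by (simp add: convergent_Suc_iff)
  moreover have "\<forall>\<^sub>F n in sequentially. \<bar>b 0 n / real n - y n\<bar> < \<epsilon>"
  proof -
    have "(\<lambda>n. R / real n) \<longlonglongrightarrow> 0"
      by (rule lim_const_over_n)
    then have "\<forall>\<^sub>F n in sequentially. R / real n < \<epsilon> / 2"
      using \<epsilon> by (intro order_tendstoD) auto
    with eventually_gt_at_top[of 0] show ?thesis
    proof eventually_elim
      case (elim n)
      have "b 0 n / real n - y n = (real m * b 0 n - (\<Sum>k<n. b k m)) / (real n * real m)"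
        using elim(1) m(1) by (simp add: y_def field_simps)
      also have "\<bar>\<dots>\<bar> \<le> (real n * C + real m * R) / (real n * real m)"
        unfolding abs_divide using main[of n] elim(1) m(1) by (simp add: divide_right_mono)
      also have "\<dots> = C / real m + R / real n"
        using elim(1) m(1) by (simp add: field_simps)
      finally show ?case
        using elim(2) m(2) by linarith
    qed
  qed
  ultimately show "\<exists>y. convergent y \<and> (\<forall>\<^sub>F n in sequentially. \<bar>b 0 n / real n - y n\<bar> < \<epsilon>)"
    by blast
qed

subsection \<open>Sequences over a finite alphabet\<close>

text \<open>A sequence is read as an expansion in powers of \<open>c\<close>. For \<open>c\<close>
  small against the least gap between letters, the first differing digit outweighs all later ones,
  as in a Cantor set.\<close>

lemma finite_alphabet_embedding:
  fixes A :: "real set"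
  assumes "finite A"
  obtains h :: "(nat \<Rightarrow> real) \<Rightarrow> real" where "continuous_on (UNIV \<rightarrow> A) h" "inj_on h (UNIV \<rightarrow> A)"
proof -
  obtain D where D: "D > 0" "\<And>a. a \<in> A \<Longrightarrow> \<bar>a\<bar> \<le> D"
    using finite_imp_bounded[OF assms] unfolding bounded_pos real_norm_def by blast
  obtain \<delta> where \<delta>: "\<delta> > 0" "\<And>a b. a \<in> A \<Longrightarrow> b \<in> A \<Longrightarrow> a \<noteq> b \<Longrightarrow> \<delta> \<le> \<bar>a - b\<bar>"
  proof -
    \<comment> \<open>The extra \<open>1\<close> keeps the set nonempty when \<open>A\<close> has at
      most one letter, so that \<open>Min\<close> makes sense.\<close>
    let ?G = "insert 1 ((\<lambda>(a, b). \<bar>a - b\<bar>) ` {(a, b) \<in> A \<times> A. a \<noteq> b})"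
    have "finite ?G"
      using finite_subset[of "{(a, b) \<in> A \<times> A. a \<noteq> b}" "A \<times> A"] assms by auto
    moreover have "\<forall>x\<in>?G. x > 0"
      by auto
    ultimately show thesis
      by (intro that[of "Min ?G"]) (auto intro!: Min_le)
  qed
  \<comment> \<open>This choice gives \<open>c / (1 - c) = \<delta> / (2 * D + 1)\<close>, which
    keeps the geometric tail in \<open>gap\<close> below \<open>\<delta>\<close>.\<close>
  define c where "c = \<delta> / (\<delta> + 2 * D + 1)"
  have c: "0 < c" "c < 1"
    using \<delta>(1) D(1) by (auto simp: c_def field_simps)
  have gap: "2 * D * c / (1 - c) < \<delta>"
  proof -
    have "1 - c = (2 * D + 1) / (\<delta> + 2 * D + 1)"
      using \<delta>(1) D(1) by (simp add: c_def field_simps)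
    then have "2 * D * c / (1 - c) = 2 * D * \<delta> / (2 * D + 1)"
      using \<delta>(1) D(1) by (simp add: c_def)
    also have "\<dots> < \<delta>"
      using \<delta>(1) D(1) by (simp add: field_simps)
    finally show ?thesis .
  qed
  define h where "h x = (\<Sum>i. x i * c ^ i)" for x :: "nat \<Rightarrow> real"
  have summable_geo: "summable (\<lambda>i. K * c ^ i)" for K
    using c by (intro summable_mult summable_geometric) auto
  have term_bound: "norm (x i * c ^ i) \<le> D * c ^ i" if "x \<in> UNIV \<rightarrow> A" for x i
    using that c D(2) by (auto simp: abs_mult intro!: mult_right_mono)
  have "continuous_on (UNIV \<rightarrow> A) h"
    unfolding h_def
  proof (rule uniform_limit_theorem)
    show "uniform_limit (UNIV \<rightarrow> A) (\<lambda>n x. \<Sum>i<n. x i * c ^ i) (\<lambda>x. \<Sum>i. x i * c ^ i) sequentially"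
      by (rule Weierstrass_m_test[OF term_bound summable_geo])
    show "\<forall>\<^sub>F n in sequentially. continuous_on (UNIV \<rightarrow> A) (\<lambda>x. \<Sum>i<n. x i * c ^ i)"
      by (intro always_eventually allI continuous_intros continuous_on_subset[OF continuous_on_product_coordinates]) auto
  qed simp
  moreover have "inj_on h (UNIV \<rightarrow> A)"
  proof (rule inj_onI, rule ccontr)
    fix x y :: "nat \<Rightarrow> real"
    assume x: "x \<in> UNIV \<rightarrow> A" and y: "y \<in> UNIV \<rightarrow> A" and eq: "h x = h y" and "x \<noteq> y"
    define n where "n = (LEAST n. x n \<noteq> y n)"
    have "\<exists>n. x n \<noteq> y n"
      using \<open>x \<noteq> y\<close> by auto
    then have n: "x n \<noteq> y n" "\<And>i. i < n \<Longrightarrow> x i = y i"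
      unfolding n_def using LeastI_ex not_less_Least by (fast, blast)
    let ?d = "\<lambda>i. (x i - y i) * c ^ i"
    have "summable (\<lambda>i. x i * c ^ i)" "summable (\<lambda>i. y i * c ^ i)"
      by (rule summable_comparison_test'[OF summable_geo], rule term_bound[OF x],
          rule summable_comparison_test'[OF summable_geo], rule term_bound[OF y])
    then have d: "summable ?d" "suminf ?d = 0"
      using eq by (auto simp: h_def left_diff_distrib suminf_diff[symmetric] intro: summable_diff)
    \<comment> \<open>The expansions have equal sums and agree before \<open>n\<close>, so the tail
      would have to cancel the term at \<open>n\<close>; it is too small for that.\<close>
    have "suminf ?d = (\<Sum>i. ?d (i + Suc n)) + (\<Sum>i<Suc n. ?d i)"
      by (rule suminf_split_initial_segment[OF d(1)])
    also have "(\<Sum>i<Suc n. ?d i) = ?d n"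
      using n(2) by simp
    finally have "\<bar>?d n\<bar> = \<bar>\<Sum>i. ?d (i + Suc n)\<bar>"
      using d(2) by simp
    also have "\<dots> \<le> (\<Sum>i. 2 * D * c ^ Suc n * c ^ i)"
    proof -
      have "norm (?d (i + Suc n)) \<le> 2 * D * c ^ Suc n * c ^ i" for i
      proof -
        have "\<bar>x (i + Suc n) - y (i + Suc n)\<bar> \<le> 2 * D"
        proof -
          have "\<bar>x (i + Suc n)\<bar> \<le> D" "\<bar>y (i + Suc n)\<bar> \<le> D"
            using x y by (blast intro: D(2))+
          then show ?thesis
            by linarith
        qed
        then show ?thesis
          using c mult_right_mono[of _ "2 * D" "c ^ (i + Suc n)"] by (simp add: abs_mult power_add mult_ac)
      qed
      then show ?thesis
        unfolding real_norm_def[symmetric] by (rule norm_suminf_le[OF _ summable_geo])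
    qed
    also have "\<dots> = c ^ n * (2 * D * c / (1 - c))"
      using c by (subst suminf_mult) (auto simp: suminf_geometric summable_geometric)
    also have "\<dots> < c ^ n * \<delta>"
      using gap c(1) by (intro mult_strict_left_mono) auto
    also have "\<dots> \<le> c ^ n * \<bar>x n - y n\<bar>"
      using \<delta>(2)[of "x n" "y n"] n(1) x y c by (intro mult_left_mono) auto
    finally show False
      using c by (simp add: abs_mult mult.commute)
  qed
  ultimately show thesis
    by (rule that)
qed

text \<open>Tychonoff's theorem, carried over to the topology of the function type.\<close>

lemma compact_Pi_UNIV:
  fixes A :: "'b::topological_space set"
  assumes "compact A"
  shows "compact (UNIV \<rightarrow> A :: ('a \<Rightarrow> 'b) set)"
proof -
  have "compactin (product_topology (\<lambda>_. euclidean) UNIV) (Pi\<^sub>E (UNIV :: 'a set) (\<lambda>_. A))"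
    using assms by (simp add: compactin_PiE)
  then show ?thesis
    by (simp add: euclidean_product_topology PiE_UNIV_domain)
qed

lemma compact_orbit_closure:
  assumes "finite A" "range w \<subseteq> A"
  shows "compact (orbit_closure w)"
proof -
  have "compact ((UNIV \<rightarrow> A) \<inter> orbit_closure w)"
    using assms(1) unfolding orbit_closure_def
    by (intro compact_Int_closed compact_Pi_UNIV finite_imp_compact closed_closure)
  then show ?thesis
    using orbit_closure_subset_alphabet[OF assms] by (simp add: inf_absorb2)
qed

lemma mem_orbit_closure: "w \<in> orbit_closure w"
  unfolding orbit_closure_def by (rule subsetD[OF closure_subset], rule range_eqI[of _ _ 0]) simp

lemma continuous_on_seq_shift: "continuous_on S seq_shift"
  unfolding seq_shift_def
proof (rule continuous_on_coordinatewise_then_product)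
  show "continuous_on S (\<lambda>x. x (Suc i))" for i
    by (rule continuous_on_subset[OF continuous_on_product_coordinates subset_UNIV])
qed

subsection \<open>Logarithmic moment integrals\<close>

text \<open>The weights \<open>u\<close> are an argument, so that for fixed \<open>n\<close> this is
  a function on the orbit closure, to which the ergodic averages apply.\<close>

definition log_partition ::
    "((nat \<Rightarrow> 's::finite) \<Rightarrow> real) \<Rightarrow> real \<Rightarrow> (nat \<Rightarrow> real) \<Rightarrow> nat \<Rightarrow> real" where
  "log_partition f lam u n =
     ln (\<integral>x. exp (lam * (\<Sum>k<n. u k * f ((seq_shift ^^ k) x))) \<partial>uniform_bernoulli)"

text \<open>Opens the locale of \<open>comb_seq\<close>, which glues two independent Bernoulli
  sequences into one.\<close>

lemma sequence_space_uniform_count: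
  "sequence_space (uniform_count_measure (UNIV :: 's::finite set))"
proof -
  interpret prob_space "uniform_count_measure (UNIV :: 's set)"
    by (rule prob_space_uniform_count_measure) auto
  show ?thesis ..
qed

lemma prob_space_uniform_bernoulli:
  "prob_space (uniform_bernoulli :: (nat \<Rightarrow> 's::finite) measure)"
proof -
  interpret sequence_space "uniform_count_measure (UNIV :: 's set)"
    by (rule sequence_space_uniform_count)
  show ?thesis
    unfolding uniform_bernoulli_def by (rule P.prob_space_axioms)
qed

lemma borel_measurable_weighted_birkhoff:
  fixes f :: "(nat \<Rightarrow> 's::finite) \<Rightarrow> real"
  assumes "f \<in> borel_measurable uniform_bernoulli"
  shows "(\<lambda>x. lam * (\<Sum>k<n. u k * f ((seq_shift ^^ k) x))) \<in> borel_measurable uniform_bernoulli"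
  using measurable_compose[OF measurable_funpow_seq_shift assms] by measurable

lemma weighted_birkhoff_diff_le:
  fixes f :: "(nat \<Rightarrow> 's) \<Rightarrow> real"
  assumes "\<And>x. \<bar>f x\<bar> \<le> B"
  shows "\<bar>lam * (\<Sum>k<n. u k * f ((seq_shift ^^ k) x)) - lam * (\<Sum>k<n. u' k * f ((seq_shift ^^ k) x))\<bar>
    \<le> \<bar>lam\<bar> * B * (\<Sum>k<n. \<bar>u k - u' k\<bar>)"
proof -
  have "\<bar>\<Sum>k<n. (u k - u' k) * f ((seq_shift ^^ k) x)\<bar> \<le> (\<Sum>k<n. B * \<bar>u k - u' k\<bar>)"
    using assms by (intro order_trans[OF sum_abs sum_mono])
      (simp add: abs_mult mult.commute[of B] mult_left_mono)
  also have "\<dots> = B * (\<Sum>k<n. \<bar>u k - u' k\<bar>)"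
    by (simp add: sum_distrib_left)
  finally have "\<bar>lam * (\<Sum>k<n. (u k - u' k) * f ((seq_shift ^^ k) x))\<bar>
      \<le> \<bar>lam\<bar> * (B * (\<Sum>k<n. \<bar>u k - u' k\<bar>))"
    unfolding abs_mult by (rule mult_left_mono) simp
  then show ?thesis
    by (simp only: right_diff_distrib[symmetric] sum_subtractf[symmetric] left_diff_distrib[symmetric]
        mult.assoc)
qed

lemma weighted_birkhoff_bounded:
  fixes f :: "(nat \<Rightarrow> 's) \<Rightarrow> real"
  assumes "\<And>x. \<bar>f x\<bar> \<le> B"
  shows "\<bar>lam * (\<Sum>k<n. u k * f ((seq_shift ^^ k) x))\<bar> \<le> \<bar>lam\<bar> * B * (\<Sum>k<n. \<bar>u k\<bar>)"
  using weighted_birkhoff_diff_le[OF assms, where u' = "\<lambda>_. 0"] by simp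

lemma log_partition_diff_le:
  fixes f :: "(nat \<Rightarrow> 's::finite) \<Rightarrow> real"
  assumes "f \<in> borel_measurable uniform_bernoulli" and B: "\<And>x. \<bar>f x\<bar> \<le> B"
  shows "\<bar>log_partition f lam u n - log_partition f lam u' n\<bar>
    \<le> \<bar>lam\<bar> * B * (\<Sum>k<n. \<bar>u k - u' k\<bar>)"
  unfolding log_partition_def
  using borel_measurable_weighted_birkhoff[OF assms(1)] borel_measurable_weighted_birkhoff[OF assms(1)]
    weighted_birkhoff_bounded[OF B] weighted_birkhoff_bounded[OF B] weighted_birkhoff_diff_le[OF B]
  by (rule prob_space.abs_ln_expectation_exp_diff_le[OF prob_space_uniform_bernoulli])

text \<open>Compares with zero weights, for which the integral is one and its logarithm
  zero.\<close>

lemma log_partition_bounded: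
  fixes f :: "(nat \<Rightarrow> 's::finite) \<Rightarrow> real"
  assumes "f \<in> borel_measurable uniform_bernoulli" and "\<And>x. \<bar>f x\<bar> \<le> B"
  shows "\<bar>log_partition f lam u n\<bar> \<le> \<bar>lam\<bar> * B * (\<Sum>k<n. \<bar>u k\<bar>)"
  using log_partition_diff_le[OF assms, where u' = "\<lambda>_. 0"]
  by (simp add: log_partition_def prob_space.prob_space[OF prob_space_uniform_bernoulli])

text \<open>Only the first \<open>n\<close> weights enter, in a Lipschitz way, so continuity of
  finitely many coordinates suffices.\<close>

lemma continuous_on_log_partition:
  fixes f :: "(nat \<Rightarrow> 's::finite) \<Rightarrow> real"
  assumes "f \<in> borel_measurable uniform_bernoulli" and "\<And>x. \<bar>f x\<bar> \<le> B"
  shows "continuous_on Y (\<lambda>u. log_partition f lam u n)"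
  unfolding continuous_on_def
proof
  fix u assume "u \<in> Y"
  show "((\<lambda>u. log_partition f lam u n) \<longlongrightarrow> log_partition f lam u n) (at u within Y)"
  proof (rule LIM_zero_cancel, rule Lim_null_comparison)
    show "\<forall>\<^sub>F u' in at u within Y. norm (log_partition f lam u' n - log_partition f lam u n)
        \<le> \<bar>lam\<bar> * B * (\<Sum>k<n. \<bar>u' k - u k\<bar>)"
      using log_partition_diff_le[OF assms] by (intro always_eventually) simp
    have "((\<lambda>u'. u' k) \<longlongrightarrow> u k) (at u within Y)" for k
      using continuous_on_subset[OF continuous_on_product_coordinates[of k], of Y] \<open>u \<in> Y\<close>
      by (simp add: continuous_on_def)
    then have "((\<lambda>u'. \<bar>lam\<bar> * B * (\<Sum>k<n. \<bar>u' k - u k\<bar>)) \<longlongrightarrow>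
        \<bar>lam\<bar> * B * (\<Sum>k<n. \<bar>u k - u k\<bar>)) (at u within Y)"
      by (intro tendsto_intros)
    then show "((\<lambda>u'. \<bar>lam\<bar> * B * (\<Sum>k<n. \<bar>u' k - u k\<bar>)) \<longlongrightarrow> 0) (at u within Y)"
      by simp
  qed
qed

text \<open>Replacing the first \<open>n\<close> summands by their values at a point with the same first \<open>n\<close>
  coordinates costs only the distortion, and decouples them from the remaining \<open>m\<close> summands.\<close>

lemma log_partition_almost_additive:
  fixes f :: "(nat \<Rightarrow> 's::finite) \<Rightarrow> real"
  assumes meas: "f \<in> borel_measurable uniform_bernoulli" and B: "\<And>x. \<bar>f x\<bar> \<le> B"
    and C: "\<And>x y. \<forall>k<n. x k = y k \<Longrightarrow>
      (\<Sum>k<n. \<bar>u k * f ((seq_shift ^^ k) x) - u k * f ((seq_shift ^^ k) y)\<bar>) \<le> C"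
  shows "\<bar>log_partition f lam u (n + m)
    - (log_partition f lam u n + log_partition f lam ((seq_shift ^^ n) u) m)\<bar> \<le> \<bar>lam\<bar> * C"
proof -
  interpret sequence_space "uniform_count_measure (UNIV :: 's set)"
    by (rule sequence_space_uniform_count)
  interpret SS: pair_prob_space S S ..
  let ?S = "\<lambda>u n x. lam * (\<Sum>k<n. u k * f ((seq_shift ^^ k) x))"
  let ?u = "(seq_shift ^^ n) u"
  \<comment> \<open>\<open>comb_seq n x y\<close> takes its first \<open>n\<close> coordinates from
    \<open>x\<close> and the rest from \<open>y\<close>. In \<open>G\<close> the first
    \<open>n\<close> summands see \<open>x\<close> alone, so \<open>exp\<close> of it factors under
    the product measure.\<close>
  define F where "F = (\<lambda>(x, y). ?S u (n + m) (comb_seq n x y))"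
  define G where "G = (\<lambda>(x, y). ?S u n x + ?S ?u m y)"
  have S_meas [measurable]: "?S u n \<in> borel_measurable S" for u n
    using borel_measurable_weighted_birkhoff[OF meas] by (simp add: uniform_bernoulli_def)
  have F_meas: "F \<in> borel_measurable (S \<Otimes>\<^sub>M S)"
    unfolding F_def by measurable
  have G_meas: "G \<in> borel_measurable (S \<Otimes>\<^sub>M S)"
    unfolding G_def by measurable
  have lp: "log_partition f lam u n = ln (\<integral>x. exp (?S u n x) \<partial>S)" for u n
    by (simp add: log_partition_def uniform_bernoulli_def)
  have exp_pos: "0 < (\<integral>x. exp (?S u n x) \<partial>S)" for u n
    by (rule P.integrable_exp_bounded(2)[OF S_meas weighted_birkhoff_bounded[OF B]])
  have F_exp: "(\<integral>z. exp (F z) \<partial>(S \<Otimes>\<^sub>M S)) = (\<integral>x. exp (?S u (n + m) x) \<partial>S)"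
  proof -
    have "(\<integral>x. exp (?S u (n + m) x) \<partial>S)
        = (\<integral>x. exp (?S u (n + m) x) \<partial>distr (S \<Otimes>\<^sub>M S) S (\<lambda>(x, y). comb_seq n x y))"
      by (simp only: PiM_comb_seq)
    also have "\<dots> = (\<integral>z. exp (F z) \<partial>(S \<Otimes>\<^sub>M S))"
      by (subst integral_distr[OF measurable_comb_seq]) (auto simp: F_def split_beta)
    finally show ?thesis ..
  qed
  have G_exp: "(\<integral>z. exp (G z) \<partial>(S \<Otimes>\<^sub>M S)) = (\<integral>x. exp (?S u n x) \<partial>S) * (\<integral>x. exp (?S ?u m x) \<partial>S)"
  proof -
    have "integrable (S \<Otimes>\<^sub>M S) (\<lambda>z. exp (G z))"
    proof (rule SS.P.integrable_exp_bounded[OF G_meas])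
      show "\<bar>G z\<bar> \<le> \<bar>lam\<bar> * B * (\<Sum>k<n. \<bar>u k\<bar>) + \<bar>lam\<bar> * B * (\<Sum>k<m. \<bar>?u k\<bar>)" for z
        unfolding G_def split_beta
        by (intro order_trans[OF abs_triangle_ineq] add_mono weighted_birkhoff_bounded[OF B])
    qed
    from SS.integral_fst'[OF this] show ?thesis
      by (simp add: G_def exp_add)
  qed
  have FG: "\<bar>F z - G z\<bar> \<le> \<bar>lam\<bar> * C" for z
  proof -
    obtain x y where z: "z = (x, y)"
      by fastforce
    let ?c = "comb_seq n x y"
    \<comment> \<open>Shifting at least \<open>n\<close> times erases the part taken from
      \<open>x\<close>, so the last \<open>m\<close> summands depend on \<open>y\<close> only, with
      weights shifted by \<open>n\<close>.\<close>
    have split: "(\<Sum>k<n + m. u k * f ((seq_shift ^^ k) ?c))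
        = (\<Sum>k<n. u k * f ((seq_shift ^^ k) ?c)) + (\<Sum>k<m. ?u k * f ((seq_shift ^^ k) y))"
    proof -
      have sum_split: "sum g {..<n + m} = sum g {..<n} + (\<Sum>k<m. g (n + k))"
        for g :: "nat \<Rightarrow> real" and m
        by (induction m) (simp_all add: add.assoc)
      have "(seq_shift ^^ (n + k)) ?c = (seq_shift ^^ k) y" for k
        by (simp add: seq_shift_funpow comb_seq_def fun_eq_iff)
      then show ?thesis
        unfolding sum_split by (simp add: seq_shift_funpow[of n u])
    qed
    have "F z - G z = lam * (\<Sum>k<n. u k * f ((seq_shift ^^ k) ?c) - u k * f ((seq_shift ^^ k) x))"
      unfolding F_def G_def z prod.case split by (simp add: sum_subtractf algebra_simps)
    also have "\<bar>\<dots>\<bar> \<le> \<bar>lam\<bar> * C"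
      unfolding abs_mult
      by (intro mult_left_mono order_trans[OF sum_abs C]) (auto simp: comb_seq_def)
    finally show ?thesis .
  qed
  have "\<bar>ln (\<integral>z. exp (F z) \<partial>(S \<Otimes>\<^sub>M S)) - ln (\<integral>z. exp (G z) \<partial>(S \<Otimes>\<^sub>M S))\<bar> \<le> \<bar>lam\<bar> * C"
  proof (rule SS.P.abs_ln_expectation_exp_diff_le[OF F_meas G_meas _ _ FG])
    show "\<bar>F z\<bar> \<le> \<bar>lam\<bar> * B * (\<Sum>k<n + m. \<bar>u k\<bar>)" for z
      unfolding F_def split_beta by (rule weighted_birkhoff_bounded[OF B])
    show "\<bar>G z\<bar> \<le> \<bar>lam\<bar> * B * (\<Sum>k<n. \<bar>u k\<bar>) + \<bar>lam\<bar> * B * (\<Sum>k<m. \<bar>?u k\<bar>)" for z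
      unfolding G_def split_beta
      by (intro order_trans[OF abs_triangle_ineq] add_mono weighted_birkhoff_bounded[OF B])
  qed
  then show ?thesis
    unfolding F_exp G_exp lp ln_mult_pos[OF exp_pos exp_pos] .
qed

theorem theorem1p4:
  fixes A :: "real set" and w :: "nat \<Rightarrow> real" and f :: "(nat \<Rightarrow> 's::finite) \<Rightarrow> real"
  assumes "CARD('s) \<ge> 2"
    and "finite A"
    and "range w \<subseteq> A"
    and "minimal_uniquely_ergodic_seq w"
    and "bounded_variation_fun f"
  shows "(\<forall>lam::real. convergent (\<lambda>n::nat. 1 / real n *
            ln (\<integral>x. exp (lam * (\<Sum>k<n. w k * f ((seq_shift ^^ k) x))) \<partial>uniform_bernoulli)))
       \<and> (SUP N\<in>{1..}. SUP (x, y)\<in>{(x, y). \<forall>k<N. x k = y k}.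
            ennreal (\<Sum>k<N. \<bar>w k * f ((seq_shift ^^ k) x) - w k * f ((seq_shift ^^ k) y)\<bar>)) < \<infinity>"
proof -
  obtain W where W: "\<And>k. \<bar>w k\<bar> \<le> W"
    using finite_imp_bounded[OF \<open>finite A\<close>] \<open>range w \<subseteq> A\<close> unfolding bounded_pos
    by (auto simp: image_subset_iff)
  obtain v where v: "\<And>n. 0 \<le> v n" "summable v"
    "\<And>n x y. \<forall>k\<le>n. x k = y k \<Longrightarrow> \<bar>f x - f y\<bar> \<le> v n"
    using bounded_variation_modulus[OF \<open>bounded_variation_fun f\<close>] by metis
  \<comment> \<open>One constant serves both claims: it bounds the supremum in (H2) and, times
    \<open>\<bar>lam\<bar>\<close>, the defect of additivity in (H1).\<close>
  define C where "C = W * suminf v"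
  have distortion:
    "(\<Sum>k<n. \<bar>u k * f ((seq_shift ^^ k) x) - u k * f ((seq_shift ^^ k) y)\<bar>) \<le> C"
    if "\<And>k. \<bar>u k\<bar> \<le> W" "\<forall>k<n. x k = y k" for n u x y
    unfolding C_def by (rule weighted_birkhoff_distortion[OF v that])
  have "convergent (\<lambda>n. 1 / real n * log_partition f lam w n)" for lam
  proof -
    obtain B where B: "\<And>x. \<bar>f x\<bar> \<le> B"
      using bounded_variation_bounded[OF \<open>bounded_variation_fun f\<close>] by blast
    then have "B \<ge> 0"
      using abs_ge_zero order_trans by blast
    note meas = borel_measurable_bounded_variation[OF \<open>bounded_variation_fun f\<close>]
    define b where "b k m = log_partition f lam ((seq_shift ^^ k) w) m" for k m
    have shift_W: "\<bar>(seq_shift ^^ k) w i\<bar> \<le> W" for k i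
      using W by (simp add: seq_shift_funpow)
    obtain h :: "(nat \<Rightarrow> real) \<Rightarrow> real"
      where h: "continuous_on (UNIV \<rightarrow> A) h" "inj_on h (UNIV \<rightarrow> A)"
      using finite_alphabet_embedding[OF \<open>finite A\<close>] by blast
    note Y_A = orbit_closure_subset_alphabet[OF \<open>finite A\<close> \<open>range w \<subseteq> A\<close>]
    have "convergent (\<lambda>n. b 0 n / real n)"
    proof (rule almost_additive_convergent[where C = "\<bar>lam\<bar> * C" and L = "\<bar>lam\<bar> * B * W"])
      show "\<bar>b 0 (n + m) - (b 0 n + b n m)\<bar> \<le> \<bar>lam\<bar> * C" for n m
        unfolding b_def funpow_0
        by (rule log_partition_almost_additive[OF meas B distortion[OF W]])
      show "\<bar>b n m\<bar> \<le> \<bar>lam\<bar> * B * W * real m" for n m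
      proof -
        have "\<bar>b n m\<bar> \<le> \<bar>lam\<bar> * B * (\<Sum>k<m. \<bar>(seq_shift ^^ n) w k\<bar>)"
          unfolding b_def by (rule log_partition_bounded[OF meas B])
        also have "\<dots> \<le> \<bar>lam\<bar> * B * (\<Sum>k<m. W)"
          using \<open>B \<ge> 0\<close> by (intro mult_left_mono sum_mono shift_W) auto
        finally show ?thesis
          by (simp add: mult_ac)
      qed
      \<comment> \<open>For fixed \<open>m\<close> the numbers \<open>b k m\<close> are the values
        of one continuous function along the orbit of \<open>w\<close>.\<close>
      show "convergent (\<lambda>n. (\<Sum>k\<le>n. b k m) / real (Suc n))" for m
        unfolding b_def
      proof (rule uniquely_ergodic_averages_convergent[where Y = "orbit_closure w"])
        show "compact (orbit_closure w)"
          using \<open>finite A\<close> \<open>range w \<subseteq> A\<close> by (rule compact_orbit_closure)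
        show "continuous_on (orbit_closure w) h" "inj_on h (orbit_closure w)"
          using h Y_A by (blast intro: continuous_on_subset inj_on_subset)+
        show "continuous_on (orbit_closure w) seq_shift"
          by (rule continuous_on_seq_shift)
        show "seq_shift ` orbit_closure w \<subseteq> orbit_closure w"
          "uniquely_ergodic_subsystem (orbit_closure w) seq_shift"
          using \<open>minimal_uniquely_ergodic_seq w\<close>
          by (simp_all add: minimal_uniquely_ergodic_seq_def minimal_subsystem_def)
        show "w \<in> orbit_closure w"
          by (rule mem_orbit_closure)
        show "continuous_on (orbit_closure w) (\<lambda>u. log_partition f lam u m)"
          by (rule continuous_on_log_partition[OF meas B])
      qed
    qed
    then show ?thesis
      by (simp add: b_def)
  qed
  moreover have "(SUP N\<in>{1..}. SUP (x, y)\<in>{(x, y). \<forall>k<N. x k = y k}.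
      ennreal (\<Sum>k<N. \<bar>w k * f ((seq_shift ^^ k) x) - w k * f ((seq_shift ^^ k) y)\<bar>)) \<le> ennreal C"
    using distortion[OF W] by (intro SUP_least) (auto intro!: SUP_least ennreal_leI)
  then have "(SUP N\<in>{1..}. SUP (x, y)\<in>{(x, y). \<forall>k<N. x k = y k}.
      ennreal (\<Sum>k<N. \<bar>w k * f ((seq_shift ^^ k) x) - w k * f ((seq_shift ^^ k) y)\<bar>)) < \<infinity>"
    by (rule order_le_less_trans) simp
  ultimately show ?thesis
    unfolding log_partition_def by blast
qed

end
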